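(* Let $D$ be an open set in the space $\mathbb{R}^3$ with coordinates $(a_0,a_1,a_2)$, with $a_2\neq 0$ on $D$, and write $\partial_i=\frac{\partial}{\partial a_i}$ for $i=0,1,2$. Assume that smooth functions $P(a_0,a_1,a_2)$, $R(a_0,a_1,a_2)$, $S(a_0,a_1,a_2)$ on $D$ satisfy the system of PDEs $$a_1\partial_0 P=(3a_0-2a_2)\,\partial_0 R+(2a_1-3)\,\partial_1 R+a_2\,\partial_2 R,$$ $$\partial_1 P=\partial_0 R,\qquad \partial_2 P=\partial_1 R,$$ $$\partial_0 S=a_2\,\partial_1 R-2P,\qquad \partial_1 S=a_2\,\partial_2 R-2R,$$ $$\partial_2 S=a_1\,\partial_0 R+(2a_2-3a_0)\,\partial_1 R+(3-2a_1)\,\partial_2 R+P.$$ Then any smooth solution $a_k(t,x)$, $k=0,1,2$ (defined on an open set of the $(t,x)$-plane and taking values in $D$), of the system of equations $$P(a_0,a_1,a_2)=0,\qquad R(a_0,a_1,a_2)=t,\qquad S(a_0,a_1,a_2)=(3-2a_1)t-x$$ is also a solution of the quasi-linear system $$U_t+VU_x=0,\qquad U=(a_0,a_1,a_2)^T,\qquad V=\begin{pmatrix}0&0&a_1\\ a_2&0&2a_2-3a_0\\ 0&a_2&3-2a_1\end{pmatrix}.$$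
   Context: Subscripts $t$, $x$ denote partial derivatives. All functions are real-valued. *)

theory Defs
  imports "HOL-Analysis.Analysis"
begin

text \<open>The usual recursive definition of \<open>C\<^sup>k\<close> and \<open>C\<^sup>\<infinity>\<close> functions; meant for open sets \<open>X\<close> of
  a finite-dimensional space (the derivatives are two-sided, at points of \<open>X\<close>).\<close>

fun Ck_on :: "nat \<Rightarrow> ('a::euclidean_space \<Rightarrow> 'b::real_normed_vector) \<Rightarrow> 'a set \<Rightarrow> bool" where
  "Ck_on 0 f X \<longleftrightarrow> continuous_on X f"
| "Ck_on (Suc k) f X \<longleftrightarrow>
     (\<forall>x\<in>X. f differentiable (at x)) \<and>
     (\<forall>v. Ck_on k (\<lambda>x. frechet_derivative f (at x) v) X)"

definition smooth_on :: "('a::euclidean_space \<Rightarrow> 'b::real_normed_vector) \<Rightarrow> 'a set \<Rightarrow> bool" where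
  "smooth_on f X \<longleftrightarrow> (\<forall>k. Ck_on k f X)"

definition dir_deriv :: "'a::real_normed_vector \<Rightarrow> ('a \<Rightarrow> 'b::real_normed_vector) \<Rightarrow> 'a \<Rightarrow> 'b" where
  "dir_deriv e f p = vector_derivative (\<lambda>s. f (p + s *\<^sub>R e)) (at 0)"

text \<open>Components of \<open>real^3\<close> are numbered from 1 in the library, so the coordinates
  \<open>(a\<^sub>0, a\<^sub>1, a\<^sub>2)\<close> are the components \<open>1, 2, 3\<close> and \<open>\<partial>\<^sub>i\<close> is the derivative along \<open>axis (i+1) 1\<close>.\<close>

abbreviation a0 :: "real^3 \<Rightarrow> real" where "a0 p \<equiv> p $ 1"
abbreviation a1 :: "real^3 \<Rightarrow> real" where "a1 p \<equiv> p $ 2"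
abbreviation a2 :: "real^3 \<Rightarrow> real" where "a2 p \<equiv> p $ 3"

definition d0 :: "(real^3 \<Rightarrow> real) \<Rightarrow> real^3 \<Rightarrow> real" where "d0 = dir_deriv (axis 1 1)"
definition d1 :: "(real^3 \<Rightarrow> real) \<Rightarrow> real^3 \<Rightarrow> real" where "d1 = dir_deriv (axis 2 1)"
definition d2 :: "(real^3 \<Rightarrow> real) \<Rightarrow> real^3 \<Rightarrow> real" where "d2 = dir_deriv (axis 3 1)"

text \<open>Points of the plane are pairs \<open>(t, x)\<close>.\<close>

definition dt :: "(real \<times> real \<Rightarrow> real^3) \<Rightarrow> real \<times> real \<Rightarrow> real^3" where "dt = dir_deriv (1, 0)"
definition dx :: "(real \<times> real \<Rightarrow> real^3) \<Rightarrow> real \<times> real \<Rightarrow> real^3" where "dx = dir_deriv (0, 1)"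

definition V :: "real^3 \<Rightarrow> real^3^3" where
  "V p = vector [vector [0,    0,    a1 p],
                 vector [a2 p, 0,    2 * a2 p - 3 * a0 p],
                 vector [0,    a2 p, 3 - 2 * a1 p]]"

end

theory Submission
  imports Defs
begin

text \<open>
  Write \<open>k\<close> and \<open>r\<close> for the gradients of \<open>P\<close> and \<open>R\<close> at \<open>p = U(t, x)\<close>. The PDE system for
  \<open>P\<close>, \<open>R\<close>, \<open>S\<close> is a statement about row vectors: its first three equations say
  \<open>k V = a\<^sub>2 r\<close>, and the last three say, where \<open>P = 0\<close> and \<open>R = t\<close>, that \<open>r V\<close> is the
  gradient of \<open>S + 2 t a\<^sub>1\<close> with \<open>t\<close> held constant. So the three functions that define the solution
  implicitly have gradients \<open>k\<close>, \<open>k V\<close>, \<open>k V\<^sup>2\<close> up to the factor \<open>a\<^sub>2 \<noteq> 0\<close>.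

  Differentiating the implicit equations along \<open>t\<close> and \<open>x\<close> gives
  \<open>k U\<^sub>x = r U\<^sub>x = 0\<close>, \<open>r V U\<^sub>x = -1\<close> and \<open>k U\<^sub>t = 0\<close>, \<open>r U\<^sub>t = 1\<close>, \<open>r V U\<^sub>t = 3 - 2 a\<^sub>1\<close>.
  For \<open>z = U\<^sub>t + V U\<^sub>x\<close> it follows at once that \<open>k z = 0\<close> and \<open>r z = 0\<close>. Since the trace of \<open>V\<close> is
  \<open>3 - 2 a\<^sub>1\<close> and \<open>k U\<^sub>x = k V U\<^sub>x = 0\<close>, the Cayley-Hamilton theorem for \<open>V\<close> gives
  \<open>k V\<^sup>3 U\<^sub>x = (3 - 2 a\<^sub>1) k V\<^sup>2 U\<^sub>x\<close>, which is \<open>r V z = 0\<close>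
  (\<open>transport_of_gradient_relations\<close>). Thus \<open>z\<close> is annihilated by \<open>k\<close>, \<open>k V\<close> and \<open>k V\<^sup>2\<close>.

  These rows are linearly independent: applied to \<open>U\<^sub>x\<close>, \<open>V U\<^sub>x\<close>, \<open>V\<^sup>2 U\<^sub>x\<close> they give a
  matrix that is triangular up to the order of its columns, with \<open>k V\<^sup>2 U\<^sub>x = - a\<^sub>2 \<noteq> 0\<close> on its
  antidiagonal (\<open>observable_if_relative_degree_3\<close>). Hence \<open>z = 0\<close>. In particular the
  nondegeneracy of the Jacobian of the implicit equations is a consequence of the existence of the
  solution \<open>U\<close>.
\<close>

section \<open>Linear algebra\<close>

text \<open>
  The product of the matrix with rows \<open>k\<close>, \<open>k A\<close>, \<open>k A\<^sup>2\<close> and the matrix with columns \<open>u\<close>, \<open>A u\<close>,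
  \<open>A\<^sup>2 u\<close> has the entries \<open>k A\<^bsup>i+j\<^esup> u\<close>, so it vanishes above its antidiagonal and its determinant is
  \<open>- (k A\<^sup>2 u)\<^sup>3\<close>. Therefore both factors are invertible. The name is that of control theory:
  \<open>k u = k A u = 0 \<noteq> k A\<^sup>2 u\<close> is relative degree three, and the conclusion is that the
  pair \<open>(k, A)\<close> is observable.
\<close>

lemma observable_if_relative_degree_3:
  fixes A :: "real^3^3" and k u z :: "real^3"
  assumes u0: "k \<bullet> u = 0" and u1: "k \<bullet> (A *v u) = 0" and u2: "k \<bullet> (A *v (A *v u)) \<noteq> 0"
    and z0: "k \<bullet> z = 0" and z1: "k \<bullet> (A *v z) = 0" and z2: "k \<bullet> (A *v (A *v z)) = 0"
  shows "z = 0"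
proof -
  define M :: "real^3^3" where "M = vector [k, k v* A, k v* A v* A]"
  define N :: "real^3^3" where "N = transpose (vector [u, A *v u, A *v (A *v u)])"
  have M_rows: "M $ 1 = k" "M $ 2 = k v* A" "M $ 3 = k v* A v* A"
    by (simp_all add: M_def)
  have N_columns: "column 1 N = u" "column 2 N = A *v u" "column 3 N = A *v (A *v u)"
    by (simp_all add: N_def row_def)
  have entry: "(M ** N) $ i $ j = M $ i \<bullet> column j N" for i j
    by (simp add: matrix_matrix_mult_def column_def inner_vec_def)
  have "det (M ** N) = - ((k \<bullet> (A *v (A *v u))) ^ 3)"
    by (simp add: det_3 entry M_rows N_columns dot_lmul_matrix u0 u1 power3_eq_cube)
  with u2 have "det M \<noteq> 0"
    by (auto simp: det_mul)
  moreover have "M *v z = 0"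
    by (simp add: vec_eq_iff forall_3 matrix_vector_mul_component M_rows dot_lmul_matrix z0 z1 z2)
  ultimately show ?thesis
    by (metis invertible_det_nz invertible_left_inverse matrix_left_invertible_ker)
qed

lemma V_mult:
  "V p *v u = vector [a1 p * u $ 3,
                      a2 p * u $ 1 + (2 * a2 p - 3 * a0 p) * u $ 3,
                      a2 p * u $ 2 + (3 - 2 * a1 p) * u $ 3]"
  by (simp add: vec_eq_iff forall_3 V_def matrix_vector_mult_def sum_3)

lemma mult_V:
  "r v* V p = vector [a2 p * r $ 2, a2 p * r $ 3,
                      a1 p * r $ 1 + (2 * a2 p - 3 * a0 p) * r $ 2 + (3 - 2 * a1 p) * r $ 3]"
  by (simp add: vec_eq_iff forall_3 V_def vector_matrix_mult_def sum_3)

lemma Cayley_Hamilton_V: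
  "V p *v (V p *v (V p *v u)) =
     (3 - 2 * a1 p) *\<^sub>R (V p *v (V p *v u))
     + (a2 p * (2 * a2 p - 3 * a0 p)) *\<^sub>R (V p *v u) + (a1 p * (a2 p)\<^sup>2) *\<^sub>R u"
  by (simp add: vec_eq_iff forall_3 V_mult algebra_simps power2_eq_square)

text \<open>
  The hypotheses on \<open>ut\<close> and \<open>ux\<close> are the differentiated implicit equations. They say that
  \<open>z = ut + V ux\<close> is annihilated by \<open>k\<close> and by \<open>r\<close>; only the third condition, \<open>r V z = 0\<close>, needs
  the Cayley-Hamilton identity.
\<close>

lemma transport_of_gradient_relations:
  fixes k r ut ux p :: "real^3"
  assumes a2: "a2 p \<noteq> 0" and kV: "k v* V p = a2 p *\<^sub>R r"
    and kx: "k \<bullet> ux = 0" and rx: "r \<bullet> ux = 0" and rVx: "(r v* V p) \<bullet> ux = - 1"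
    and kt: "k \<bullet> ut = 0" and rt: "r \<bullet> ut = 1" and rVt: "(r v* V p) \<bullet> ut = 3 - 2 * a1 p"
  shows "ut + V p *v ux = 0"
proof -
  have kV_inner: "k \<bullet> (V p *v w) = a2 p * (r \<bullet> w)" for w
    using kV by (metis dot_lmul_matrix inner_scaleR_left)
  have rV_ux: "r \<bullet> (V p *v ux) = - 1" and rV_ut: "r \<bullet> (V p *v ut) = 3 - 2 * a1 p"
    using rVx rVt by (simp_all add: dot_lmul_matrix)
  have "a2 p * (r \<bullet> (V p *v (V p *v ux))) = k \<bullet> (V p *v (V p *v (V p *v ux)))"
    by (simp add: kV_inner)
  also have "\<dots> = a2 p * - (3 - 2 * a1 p)"
    unfolding Cayley_Hamilton_V by (simp add: inner_add_right kV_inner kx rx rV_ux algebra_simps)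
  finally have rVV_ux: "r \<bullet> (V p *v (V p *v ux)) = - (3 - 2 * a1 p)"
    using a2 by simp
  show ?thesis
  proof (rule observable_if_relative_degree_3)
    show "k \<bullet> ux = 0" "k \<bullet> (V p *v ux) = 0" "k \<bullet> (V p *v (V p *v ux)) \<noteq> 0"
      using a2 by (simp_all add: kV_inner kx rx rV_ux)
    show "k \<bullet> (ut + V p *v ux) = 0"
      by (simp add: inner_add_right kV_inner kt rx)
    show "k \<bullet> (V p *v (ut + V p *v ux)) = 0"
      by (simp add: inner_add_right kV_inner rt rV_ux)
    show "k \<bullet> (V p *v (V p *v (ut + V p *v ux))) = 0"
      by (simp add: inner_add_right kV_inner matrix_vector_right_distrib rV_ut rVV_ux
          algebra_simps)
  qed
qed

section \<open>Directional derivatives and the chain rule\<close>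

lemma smooth_on_differentiable:
  assumes "smooth_on f X" "x \<in> X"
  shows "f differentiable (at x)"
  using assms unfolding smooth_on_def by (metis Ck_on.simps(2))

lemma line_has_vector_derivative:
  assumes "f differentiable (at p)"
  shows "((\<lambda>s. f (p + s *\<^sub>R e)) has_vector_derivative frechet_derivative f (at p) e) (at 0)"
proof -
  have "((\<lambda>s. p + s *\<^sub>R e) has_vector_derivative e) (at 0)"
    by (auto intro!: derivative_eq_intros)
  moreover have "(f has_derivative frechet_derivative f (at p)) (at (p + 0 *\<^sub>R e))"
    using assms by (simp add: frechet_derivative_works)
  ultimately show ?thesis
    using vector_derivative_diff_chain_within[of "\<lambda>s. p + s *\<^sub>R e" e 0 UNIV f]
    by (auto simp: o_def intro: has_derivative_at_withinI)
qed

lemma dir_deriv_eq_frechet_derivative: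
  assumes "f differentiable (at p)"
  shows "dir_deriv e f p = frechet_derivative f (at p) e"
  unfolding dir_deriv_def by (rule vector_derivative_at[OF line_has_vector_derivative[OF assms]])

definition grad :: "(real^3 \<Rightarrow> real) \<Rightarrow> real^3 \<Rightarrow> real^3" where
  "grad f p = vector [d0 f p, d1 f p, d2 f p]"

lemma GDERIV_grad:
  assumes "f differentiable (at p)"
  shows "GDERIV f p :> grad f p"
proof -
  let ?f' = "frechet_derivative f (at p)"
  have f': "(f has_derivative ?f') (at p)"
    using assms by (simp add: frechet_derivative_works)
  then have lin: "linear ?f'"
    by (rule has_derivative_linear)
  have "?f' h = h \<bullet> grad f p" for h
  proof -
    have "h = h $ 1 *\<^sub>R axis 1 1 + h $ 2 *\<^sub>R axis 2 1 + h $ 3 *\<^sub>R axis 3 1"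
      by (simp add: vec_eq_iff forall_3 axis_def)
    then have "?f' h = ?f' (h $ 1 *\<^sub>R axis 1 1 + h $ 2 *\<^sub>R axis 2 1 + h $ 3 *\<^sub>R axis 3 1)"
      by simp
    also have "\<dots> = h \<bullet> grad f p"
      by (simp add: linear_add[OF lin] linear_scale[OF lin] grad_def d0_def d1_def d2_def
          dir_deriv_eq_frechet_derivative[OF assms] inner_vec_def sum_3)
    finally show ?thesis .
  qed
  then have "?f' = (\<lambda>h. h \<bullet> grad f p)" ..
  with f' show ?thesis
    by (simp add: gderiv_def)
qed

text \<open>
  Differentiates an implicit equation for \<open>U\<close> along \<open>e\<close>. The right-hand side is a function \<open>b\<close> of
  the line parameter \<open>s\<close> so that it may again involve \<open>U\<close>, as the term \<open>- 2 a\<^sub>1 t\<close> in the equation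
  for \<open>S\<close> does.
\<close>

lemma inner_grad_dir_deriv:
  fixes U :: "real \<times> real \<Rightarrow> real^3"
  assumes "open W" "w \<in> W" "U differentiable (at w)" "f differentiable (at (U w))"
    and eq: "\<And>s. w + s *\<^sub>R e \<in> W \<Longrightarrow> f (U (w + s *\<^sub>R e)) = b s"
    and b: "(b has_real_derivative b') (at 0)"
  shows "grad f (U w) \<bullet> dir_deriv e U w = b'"
proof -
  have line: "((\<lambda>s. U (w + s *\<^sub>R e)) has_derivative (\<lambda>s. s *\<^sub>R dir_deriv e U w)) (at 0)"
    using line_has_vector_derivative[OF assms(3), of e] dir_deriv_eq_frechet_derivative[OF assms(3), of e]
    by (simp add: has_vector_derivative_def)
  have "(f has_derivative (\<lambda>h. h \<bullet> grad f (U w))) (at (U (w + 0 *\<^sub>R e)))"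
    using GDERIV_grad[OF assms(4)] by (simp add: gderiv_def)
  from has_derivative_compose[OF line this]
  have "((\<lambda>s. f (U (w + s *\<^sub>R e))) has_real_derivative grad f (U w) \<bullet> dir_deriv e U w) (at 0)"
    by (simp add: has_field_derivative_def inner_commute mult_commute_abs)
  moreover have "((\<lambda>s. f (U (w + s *\<^sub>R e))) has_real_derivative b') (at 0)"
  proof (rule has_field_derivative_transform_within_open[OF b])
    show "open ((\<lambda>s. w + s *\<^sub>R e) -` W)"
      by (intro open_vimage assms continuous_intros)
  qed (use assms in auto)
  ultimately show ?thesis
    by (rule DERIV_unique)
qed

section \<open>Solutions of the implicit system\<close>

theorem theorem8:
  fixes D :: "(real^3) set" and P R S :: "real^3 \<Rightarrow> real"
    and W :: "(real \<times> real) set" and U :: "real \<times> real \<Rightarrow> real^3"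
  assumes "open D" and "\<And>p. p \<in> D \<Longrightarrow> a2 p \<noteq> 0"
    and "smooth_on P D" and "smooth_on R D" and "smooth_on S D"
    and "\<And>p. p \<in> D \<Longrightarrow>
           a1 p * d0 P p = (3 * a0 p - 2 * a2 p) * d0 R p + (2 * a1 p - 3) * d1 R p + a2 p * d2 R p"
    and "\<And>p. p \<in> D \<Longrightarrow> d1 P p = d0 R p"
    and "\<And>p. p \<in> D \<Longrightarrow> d2 P p = d1 R p"
    and "\<And>p. p \<in> D \<Longrightarrow> d0 S p = a2 p * d1 R p - 2 * P p"
    and "\<And>p. p \<in> D \<Longrightarrow> d1 S p = a2 p * d2 R p - 2 * R p"
    and "\<And>p. p \<in> D \<Longrightarrow>
           d2 S p = a1 p * d0 R p + (2 * a2 p - 3 * a0 p) * d1 R p + (3 - 2 * a1 p) * d2 R p + P p"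
    and "open W" and "smooth_on U W" and "U ` W \<subseteq> D"
    and "\<And>t x. (t, x) \<in> W \<Longrightarrow> P (U (t, x)) = 0"
    and "\<And>t x. (t, x) \<in> W \<Longrightarrow> R (U (t, x)) = t"
    and "\<And>t x. (t, x) \<in> W \<Longrightarrow> S (U (t, x)) = (3 - 2 * a1 (U (t, x))) * t - x"
  shows "\<forall>t x. (t, x) \<in> W \<longrightarrow> dt U (t, x) + V (U (t, x)) *v dx U (t, x) = 0"
proof (intro allI impI)
  fix t x assume w: "(t, x) \<in> W"
  define p where "p = U (t, x)"
  have p: "p \<in> D"
    using assms(14) w by (auto simp: p_def)
  note pde = assms(6-11)[OF p]
  have P0: "P p = 0" and Rt: "R p = t"
    using assms(15,16)[OF w] by (simp_all add: p_def)
  have U: "U differentiable (at (t, x))"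
    using assms(13) w by (rule smooth_on_differentiable)
  have diff: "P differentiable (at (U (t, x)))" "R differentiable (at (U (t, x)))"
    "S differentiable (at (U (t, x)))"
    using assms(3-5) p by (auto simp: p_def intro: smooth_on_differentiable)
  have a1_deriv: "((\<lambda>s. a1 (U ((t, x) + s *\<^sub>R e))) has_real_derivative dir_deriv e U (t, x) $ 2) (at 0)"
    for e
    unfolding has_real_derivative_iff_has_vector_derivative
      dir_deriv_eq_frechet_derivative[OF U]
    by (rule bounded_linear.has_vector_derivative[OF bounded_linear_vec_nth
          line_has_vector_derivative[OF U]])
  note along = inner_grad_dir_deriv[OF assms(12) w U]

  have Pt: "grad P p \<bullet> dt U (t, x) = 0"
    unfolding dt_def p_def by (rule along[OF diff(1), where b = "\<lambda>s. 0"]) (auto simp: assms(15))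
  have Px: "grad P p \<bullet> dx U (t, x) = 0"
    unfolding dx_def p_def by (rule along[OF diff(1), where b = "\<lambda>s. 0"]) (auto simp: assms(15))
  have Rt': "grad R p \<bullet> dt U (t, x) = 1"
    unfolding dt_def p_def
    by (rule along[OF diff(2), where b = "\<lambda>s. t + s"])
       (auto simp: assms(16) intro!: derivative_eq_intros)
  have Rx: "grad R p \<bullet> dx U (t, x) = 0"
    unfolding dx_def p_def
    by (rule along[OF diff(2), where b = "\<lambda>s. t"]) (auto simp: assms(16))
  have St: "grad S p \<bullet> dt U (t, x) = (3 - 2 * a1 p) - 2 * t * dt U (t, x) $ 2"
    unfolding dt_def p_def
    by (rule along[OF diff(3),
          where b = "\<lambda>s. (3 - 2 * a1 (U ((t, x) + s *\<^sub>R (1, 0)))) * (t + s) - x"])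
       (auto simp: assms(17) intro!: derivative_eq_intros a1_deriv[of "(1, 0)", simplified])
  have Sx: "grad S p \<bullet> dx U (t, x) = - 1 - 2 * t * dx U (t, x) $ 2"
    unfolding dx_def p_def
    by (rule along[OF diff(3),
          where b = "\<lambda>s. (3 - 2 * a1 (U ((t, x) + s *\<^sub>R (0, 1)))) * t - (x + s)"])
       (auto simp: assms(17) intro!: derivative_eq_intros a1_deriv[of "(0, 1)", simplified])

  have kV: "grad P p v* V p = a2 p *\<^sub>R grad R p"
    using pde(1-3) by (simp add: mult_V vec_eq_iff forall_3 grad_def algebra_simps)
  \<comment> \<open>The terms \<open>-2 P\<close> and \<open>P\<close> in the equations for \<open>S\<close> vanish on the solution, while
    \<open>-2 R = -2 t\<close> is cancelled by the gradient of \<open>2 t a\<^sub>1\<close>, which comes from the third implicit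
    equation.\<close>
  have rV: "grad R p v* V p = grad S p + (2 * t) *\<^sub>R axis 2 1"
    using pde(4-6) P0 Rt
    by (simp add: mult_V vec_eq_iff forall_3 grad_def axis_def algebra_simps)
  show "dt U (t, x) + V (U (t, x)) *v dx U (t, x) = 0"
    unfolding p_def[symmetric]
    by (rule transport_of_gradient_relations[OF assms(2)[OF p] kV Px Rx _ Pt Rt'])
       (simp_all add: rV inner_add_left inner_axis' St Sx)
qed

end
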